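(* For a test function $\phi:\mathbb{R}^k\times\mathbb{R}^k\to[0,1]$ and $\mu_1,\mu_2\in\mathbb{R}^k$ define $$F_\phi(\mu_1,\mu_2)=E_{\beta_0,D_{\beta_0}^{-1}\mu_2}\,\phi(S,T)\,S'C_{\beta_0}\mu_1=\int\phi(s,t)\,s'C_{\beta_0}\mu_1\cdot f^S_{\beta_0}(s)\,f^T_{\beta_0,D_{\beta_0}^{-1}\mu_2}(t)\,d(s,t).$$ For $k>1$, there exists a test function $\phi:\mathbb{R}^k\times\mathbb{R}^k\to[0,1]$ such that $F_\phi(\mu_1,\mu_1)=0$ for all $\mu_1$, and $F_\phi(\mu_1,\mu_2)\neq0$ for some $\mu_1$ and $\mu_2$.
   Context: Fix $\beta_0\in\mathbb{R}$ and a symmetric positive definite $2k\times2k$ matrix $\Sigma$. Write $a_0=(\beta_0,1)'$, $b_0=(1,-\beta_0)'$, and $$C_{\beta_0}=[(b_0'\otimes I_k)\Sigma(b_0\otimes I_k)]^{-1/2},\qquad D_{\beta_0}=[(a_0'\otimes I_k)\Sigma^{-1}(a_0\otimes I_k)]^{1/2}.$$ Under $(\beta_0,\mu)$, $S\sim N(0,I_k)$ with density $f^S_{\beta_0}$ and $T\sim N(D_{\beta_0}\mu,I_k)$ with density $f^T_{\beta_0,\mu}$ are independent. Test functions are measurable. *)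

theory Defs
  imports "HOL-Probability.Probability"
begin

text \<open>Euclidean space of dimension \<open>k\<close> is \<^typ>\<open>real ^ 'k\<close>, so \<open>k = CARD('k)\<close>.  A \<open>2k \<times> 2k\<close>
  matrix is indexed by pairs in \<^typ>\<open>2 \<times> 'k\<close>: the first component selects one of the two blocks,
  the second the position inside the block.\<close>

definition sym_pos_def :: "real ^ 'n ^ 'n \<Rightarrow> bool" where
  "sym_pos_def A \<longleftrightarrow> transpose A = A \<and> (\<forall>x. x \<noteq> 0 \<longrightarrow> x \<bullet> (A *v x) > 0)"

text \<open>Such a \<open>B\<close> exists and is unique if \<open>A\<close> is symmetric positive definite; other \<open>A\<close> are not used.\<close>

definition spd_sqrt :: "real ^ 'n ^ 'n \<Rightarrow> real ^ 'n ^ 'n" where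
  "spd_sqrt A = (THE B. sym_pos_def B \<and> B ** B = A)"

text \<open>The Kronecker product \<open>v \<otimes> B\<close> of a column vector with a matrix.  The column index set
  \<open>1 \<times> 'm\<close> is identified with \<open>'m\<close>.\<close>

definition kron_vec :: "real ^ 'a \<Rightarrow> real ^ 'm ^ 'n \<Rightarrow> real ^ 'm ^ ('a \<times> 'n)" where
  "kron_vec v B = (\<chi> p. \<chi> j. v $ fst p * B $ snd p $ j)"

definition a0 :: "real \<Rightarrow> real ^ 2" where
  "a0 \<beta>\<^sub>0 = vector [\<beta>\<^sub>0, 1]"

definition b0 :: "real \<Rightarrow> real ^ 2" where
  "b0 \<beta>\<^sub>0 = vector [1, - \<beta>\<^sub>0]"

definition C_mat :: "real \<Rightarrow> real ^ (2 \<times> 'k) ^ (2 \<times> 'k) \<Rightarrow> real ^ 'k ^ 'k" where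
  "C_mat \<beta>\<^sub>0 \<Sigma> = matrix_inv (spd_sqrt
     (transpose (kron_vec (b0 \<beta>\<^sub>0) (mat 1)) ** \<Sigma> ** kron_vec (b0 \<beta>\<^sub>0) (mat 1)))"

definition D_mat :: "real \<Rightarrow> real ^ (2 \<times> 'k) ^ (2 \<times> 'k) \<Rightarrow> real ^ 'k ^ 'k" where
  "D_mat \<beta>\<^sub>0 \<Sigma> = spd_sqrt
     (transpose (kron_vec (a0 \<beta>\<^sub>0) (mat 1)) ** matrix_inv \<Sigma> ** kron_vec (a0 \<beta>\<^sub>0) (mat 1))"

text \<open>The Lebesgue density of \<open>N(m, I\<^sub>k)\<close>.\<close>

definition gauss_density :: "real ^ 'k \<Rightarrow> real ^ 'k \<Rightarrow> real" where
  "gauss_density m x =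
     (2 * pi) powr (- real CARD('k) / 2) * exp (- (norm (x - m))\<^sup>2 / 2)"

definition f_S :: "real ^ 'k \<Rightarrow> real" where
  "f_S = gauss_density 0"

definition f_T :: "real \<Rightarrow> real ^ (2 \<times> 'k) ^ (2 \<times> 'k) \<Rightarrow> real ^ 'k \<Rightarrow> real ^ 'k \<Rightarrow> real" where
  "f_T \<beta>\<^sub>0 \<Sigma> \<mu> = gauss_density (D_mat \<beta>\<^sub>0 \<Sigma> *v \<mu>)"

definition test_function :: "((real ^ 'k) \<times> (real ^ 'k) \<Rightarrow> real) \<Rightarrow> bool" where
  "test_function \<phi> \<longleftrightarrow> \<phi> \<in> borel_measurable borel \<and> (\<forall>z. \<phi> z \<in> {0..1})"

definition F :: "real \<Rightarrow> real ^ (2 \<times> 'k) ^ (2 \<times> 'k) \<Rightarrow> ((real ^ 'k) \<times> (real ^ 'k) \<Rightarrow> real)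
    \<Rightarrow> real ^ 'k \<Rightarrow> real ^ 'k \<Rightarrow> real" where
  "F \<beta>\<^sub>0 \<Sigma> \<phi> \<mu>\<^sub>1 \<mu>\<^sub>2 =
     (LINT (s, t)|lborel. \<phi> (s, t) * (s \<bullet> (C_mat \<beta>\<^sub>0 \<Sigma> *v \<mu>\<^sub>1))
        * f_S s * f_T \<beta>\<^sub>0 \<Sigma> (matrix_inv (D_mat \<beta>\<^sub>0 \<Sigma>) *v \<mu>\<^sub>2) t)"

text \<open>The joint law is a product because \<open>S\<close> and \<open>T\<close> are independent.\<close>

definition law_ST :: "real \<Rightarrow> real ^ (2 \<times> 'k) ^ (2 \<times> 'k) \<Rightarrow> real ^ 'k
    \<Rightarrow> ((real ^ 'k) \<times> (real ^ 'k)) measure" where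
  "law_ST \<beta>\<^sub>0 \<Sigma> \<mu> = density lborel f_S \<Otimes>\<^sub>M density lborel (f_T \<beta>\<^sub>0 \<Sigma> \<mu>)"

lemma gauss_density_eq_prod:
  "gauss_density m x = (\<Prod>i\<in>UNIV. normal_density (m $ i) 1 (x $ i))"
proof -
  have "(norm (x - m))\<^sup>2 = (\<Sum>i\<in>UNIV. (x $ i - m $ i)\<^sup>2)"
    unfolding power2_norm_eq_inner inner_vec_def by (simp add: power2_eq_square)
  then have e: "exp (- (norm (x - m))\<^sup>2 / 2) = (\<Prod>i\<in>UNIV. exp (- (x $ i - m $ i)\<^sup>2 / 2))"
    by (simp add: exp_sum[symmetric] sum_negf sum_divide_distrib)
  have "(2 * pi) powr (- real CARD('a) / 2) = ((2 * pi) powr (- 1 / 2)) ^ CARD('a)"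
    by (simp add: powr_realpow[symmetric] powr_powr)
  also have "(2 * pi) powr (- 1 / 2) = 1 / sqrt (2 * pi)"
    by (simp add: powr_minus_divide powr_half_sqrt)
  finally show ?thesis
    unfolding gauss_density_def e
    by (simp add: normal_density_def prod.distrib prod_dividef power_one_over)
qed

lemma borel_measurable_gauss_density [measurable]: "gauss_density m \<in> borel_measurable borel"
  unfolding gauss_density_def by measurable

lemma F_eq_expectation:
  fixes \<phi> :: "(real ^ 'k) \<times> (real ^ 'k) \<Rightarrow> real"
  assumes "test_function \<phi>"
  shows "F \<beta>\<^sub>0 \<Sigma> \<phi> \<mu>\<^sub>1 \<mu>\<^sub>2 =
    (LINT (s, t)|law_ST \<beta>\<^sub>0 \<Sigma> (matrix_inv (D_mat \<beta>\<^sub>0 \<Sigma>) *v \<mu>\<^sub>2).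
       \<phi> (s, t) * (s \<bullet> (C_mat \<beta>\<^sub>0 \<Sigma> *v \<mu>\<^sub>1)))"
proof -
  let ?c = "C_mat \<beta>\<^sub>0 \<Sigma> *v \<mu>\<^sub>1"
  let ?g = "f_T \<beta>\<^sub>0 \<Sigma> (matrix_inv (D_mat \<beta>\<^sub>0 \<Sigma>) *v \<mu>\<^sub>2)"
  have \<phi>: "\<phi> \<in> borel_measurable borel"
    using assms by (simp add: test_function_def)
  have fS [measurable]: "f_S \<in> borel_measurable (borel :: (real ^ 'k) measure)"
    and g [measurable]: "?g \<in> borel_measurable borel"
    by (simp_all add: f_S_def f_T_def borel_measurable_gauss_density)
  have pos: "f_S s \<ge> 0" "?g t \<ge> 0" for s t :: "real ^ 'k"
    by (simp_all add: f_S_def f_T_def gauss_density_def)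
  have h: "(\<lambda>(s, t). \<phi> (s, t) * (s \<bullet> ?c)) \<in> borel_measurable borel"
    using \<phi> unfolding borel_prod[symmetric] by measurable
  have fg: "(\<lambda>(s :: real ^ 'k, t). f_S s * ?g t) \<in> borel_measurable borel"
    unfolding borel_prod[symmetric] case_prod_unfold
    by (intro borel_measurable_times measurable_compose[OF measurable_fst fS]
        measurable_compose[OF measurable_snd g])
  have sf: "sigma_finite_measure (density lborel ?g)"
    by (subst sigma_finite_measure.sigma_finite_iff_density_finite[OF sigma_finite_lborel]) auto
  have "law_ST \<beta>\<^sub>0 \<Sigma> (matrix_inv (D_mat \<beta>\<^sub>0 \<Sigma>) *v \<mu>\<^sub>2)
      = density (lborel \<Otimes>\<^sub>M lborel) (\<lambda>(s, t). ennreal (f_S s) * ennreal (?g t))"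
    unfolding law_ST_def
    by (rule pair_measure_density[OF _ _ sigma_finite_lborel sf]) auto
  also have "\<dots> = density lborel (\<lambda>z. ennreal ((\<lambda>(s, t). f_S s * ?g t) z))"
    by (simp add: lborel_prod case_prod_unfold ennreal_mult pos)
  finally show ?thesis
    using h fg
    by (simp add: F_def integral_real_density pos case_prod_unfold mult_ac)
qed

end

theory Submission
  imports Defs
begin

text \<open>
  Write \<open>C\<close> for \<open>C_mat\<close>.  The idea is to find a test function whose moment is
  \<open>F_\<phi>(\<mu>\<^sub>1, \<mu>\<^sub>2) = K(\<mu>\<^sub>2) (A \<mu>\<^sub>2 \<bullet> C \<mu>\<^sub>1)\<close> with a positive factor \<open>K(\<mu>\<^sub>2)\<close> and a linear map \<open>A\<close> that can
  be chosen freely up to scaling.  Since \<open>C\<close> is symmetric and invertible, taking \<open>A\<close> proportional to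
  \<open>C\<^sup>-\<^sup>1 J\<close> turns the bilinear form into a multiple of \<open>J \<mu>\<^sub>2 \<bullet> \<mu>\<^sub>1\<close>.  If \<open>J\<close> is skew-symmetric, this vanishes
  on the diagonal; and a nonzero skew-symmetric \<open>J\<close> exists exactly when the dimension is at least two,
  for instance the rotation by a right angle in the plane of two coordinates, composed with the
  projection to that plane.

  Such a test function is obtained by exponential tilting:
  \<open>\<phi>(s, t) = exp (s \<bullet> A t - |s|\<^sup>2 / 2 - |A t|\<^sup>2 / 4 - |t|\<^sup>2 / 2)\<close>, which has values in \<open>[0, 1]\<close> as soon as \<open>A\<close>
  is a contraction (\<open>tilt_test_le_1\<close>).  For a Gaussian weight, a linear tilt shifts the centre, and
  the first moment of the tilted weight is proportional to the tilt (\<open>tilted_gaussian_first_moment\<close>).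
  Applied in \<open>s\<close>, this gives a multiple of \<open>A t \<bullet> C \<mu>\<^sub>1\<close>; applied in \<open>t\<close>, where the density of \<open>T\<close> supplies
  the tilt \<open>\<mu>\<^sub>2\<close>, it gives \<open>A \<mu>\<^sub>2 \<bullet> C \<mu>\<^sub>1\<close> (\<open>tilt_test_moment\<close>).

  What remains is linear algebra: \<open>C\<close> and \<open>D_mat\<close> are defined through a definite description of a
  square root, and are invertible because a symmetric positive definite matrix has exactly one
  symmetric positive definite square root.  Existence is Banach's fixed point theorem for a rescaled
  problem (\<open>contraction_has_symmetric_root\<close>), uniqueness a trace argument
  (\<open>sym_pos_def_sqrt_unique\<close>).
\<close>

section \<open>Symmetric positive definite matrices and their square roots\<close>

lemma sym_pos_defD:
  assumes "sym_pos_def A"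
  shows sym_pos_def_symmetric: "transpose A = A"
    and sym_pos_def_pos: "x \<noteq> 0 \<Longrightarrow> x \<bullet> (A *v x) > 0"
    and sym_pos_def_nonneg: "x \<bullet> (A *v x) \<ge> 0"
  using assms by (auto simp: sym_pos_def_def)
    (metis inner_zero_left order.refl order.strict_implies_order)

lemma inner_matrix_vector:
  fixes A :: "real ^ 'n ^ 'm"
  shows "x \<bullet> (A *v y) = (transpose A *v x) \<bullet> y"
  by (metis dot_lmul_matrix vector_transpose_matrix transpose_transpose)

lemma matrix_inv_right_inverse:
  assumes "invertible A"
  shows "A ** matrix_inv A = mat 1"
  using someI_ex[OF assms[unfolded invertible_def]] by (simp add: matrix_inv_def)

lemma sym_pos_def_invertible:
  fixes A :: "real ^ 'n ^ 'n"
  assumes "sym_pos_def A"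
  shows "invertible A"
proof -
  have "x = 0" if "A *v x = 0" for x
    using sym_pos_def_pos[OF assms, of x] that by force
  then show ?thesis
    by (simp add: invertible_left_inverse matrix_left_invertible_ker)
qed

lemma sym_pos_def_matrix_inv:
  fixes A :: "real ^ 'n ^ 'n"
  assumes A: "sym_pos_def A"
  shows "sym_pos_def (matrix_inv A)"
proof -
  note inv = matrix_inv_right_inverse[OF sym_pos_def_invertible[OF A]]
  have "transpose (matrix_inv A) ** A = mat 1"
    by (metis inv matrix_transpose_mul sym_pos_def_symmetric[OF A] transpose_mat)
  then have "transpose (matrix_inv A) = matrix_inv A"
    by (metis inv matrix_mul_assoc matrix_mul_lid matrix_mul_rid)
  moreover have "x \<bullet> (matrix_inv A *v x) > 0" if "x \<noteq> 0" for x
  proof -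
    let ?y = "matrix_inv A *v x"
    have x: "A *v ?y = x"
      by (simp add: matrix_vector_mul_assoc inv)
    then have "?y \<noteq> 0"
      using that by force
    then have "?y \<bullet> (A *v ?y) > 0"
      by (rule sym_pos_def_pos[OF A])
    then show ?thesis
      by (simp add: x inner_commute)
  qed
  ultimately show ?thesis
    by (simp add: sym_pos_def_def)
qed

lemma sym_pos_def_congruence:
  fixes A :: "real ^ 'n ^ 'n" and K :: "real ^ 'm ^ 'n"
  assumes A: "sym_pos_def A" and K: "\<And>x. K *v x = 0 \<Longrightarrow> x = 0"
  shows "sym_pos_def (transpose K ** A ** K)"
proof -
  have "x \<bullet> ((transpose K ** A ** K) *v x) = (K *v x) \<bullet> (A *v (K *v x))" for x
    by (simp only: matrix_vector_mul_assoc[symmetric] inner_matrix_vector[of _ "transpose K"]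
        transpose_transpose)
  then show ?thesis
    using sym_pos_def_pos[OF A] K sym_pos_def_symmetric[OF A]
    by (auto simp: sym_pos_def_def matrix_transpose_mul matrix_mul_assoc)
qed

text \<open>With \<open>X = B - A\<close>, the equation \<open>A\<^sup>2 = B\<^sup>2\<close> becomes \<open>B X = - X A\<close>.  Hence \<open>X B X\<close> and \<open>X A X\<close>, which are
  both positive semidefinite, have opposite traces; so both traces vanish, and positivity of \<open>B\<close>
  forces \<open>X = 0\<close>.\<close>

lemma sym_pos_def_sqrt_unique:
  fixes A B :: "real ^ 'n ^ 'n"
  assumes A: "sym_pos_def A" and B: "sym_pos_def B" and eq: "A ** A = B ** B"
  shows "A = B"
proof -
  define X where "X = B - A"
  have X: "transpose X = X"
    using sym_pos_def_symmetric[OF A] sym_pos_def_symmetric[OF B]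
    by (simp add: X_def transpose_def vec_eq_iff)
  have "B ** X = - (X ** A)"
  proof -
    have "B ** X = B ** B - B ** A" "X ** A = B ** A - A ** A"
      by (simp_all add: X_def matrix_matrix_mult_def vec_eq_iff sum_subtractf algebra_simps)
    then show ?thesis
      by (simp add: eq)
  qed
  \<comment> \<open>The trace of \<open>X M X\<close> is a sum of values of the quadratic form of \<open>M\<close> at the columns of \<open>X\<close>.\<close>
  have tr: "trace (X ** M ** X) = (\<Sum>j\<in>UNIV. (X *v axis j 1) \<bullet> (M *v (X *v axis j 1)))"
    for M :: "real ^ 'n ^ 'n"
  proof -
    have "(X ** M ** X) $ j $ j = axis j 1 \<bullet> ((X ** M ** X) *v axis j 1)" for j
      by (simp add: inner_axis' matrix_vector_mul_component inner_axis)
    also have "\<dots> j = (X *v axis j 1) \<bullet> (M *v (X *v axis j 1))" for j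
      by (simp add: inner_matrix_vector X matrix_vector_mul_assoc[symmetric])
    finally show ?thesis
      by (simp add: trace_def)
  qed
  have "X ** B ** X = - (X ** (X ** A))"
    using \<open>B ** X = - (X ** A)\<close> by (simp add: matrix_mul_assoc[symmetric])
       (simp add: matrix_matrix_mult_def vec_eq_iff sum_negf)
  then have "trace (X ** B ** X) = - trace (X ** (X ** A))"
    by (simp add: trace_def sum_negf)
  also have "trace (X ** (X ** A)) = trace (X ** A ** X)"
    by (rule trace_mul_sym)
  finally have "trace (X ** B ** X) = - trace (X ** A ** X)" .
  moreover have "trace (X ** A ** X) \<ge> 0"
    unfolding tr by (intro sum_nonneg sym_pos_def_nonneg[OF A])
  moreover have "trace (X ** B ** X) \<ge> 0"
    unfolding tr by (intro sum_nonneg sym_pos_def_nonneg[OF B])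
  ultimately have "trace (X ** B ** X) = 0"
    by linarith
  then have "(X *v axis j 1) \<bullet> (B *v (X *v axis j 1)) = 0" for j
    unfolding tr by (subst (asm) sum_nonneg_eq_0_iff) (auto intro: sym_pos_def_nonneg[OF B])
  then have "X *v axis j 1 = 0" for j
    by (metis sym_pos_def_pos[OF B] less_irrefl)
  then have "X = 0"
    by (simp add: vec_eq_iff matrix_vector_mul_component inner_axis)
  then show ?thesis
    by (simp add: X_def)
qed

text \<open>The equation \<open>2 Z = Y + Z\<^sup>2\<close> says \<open>(I - Z)\<^sup>2 = I - Y\<close>, so \<open>I - Z\<close> is a square root of \<open>I - Y\<close>
  near the identity.  The map \<open>Z \<mapsto> (Y + Z\<^sup>2) / 2\<close> preserves the closed set of self-adjoint operators of norm at
  most \<open>q = norm Y\<close> and contracts it with factor \<open>q\<close>, so Banach's fixed point theorem applies.\<close>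

lemma contraction_has_symmetric_root:
  fixes Y :: "'a::euclidean_space \<Rightarrow>\<^sub>L 'a"
  assumes Y: "norm Y < 1" and sym: "\<And>x y. blinfun_apply Y x \<bullet> y = x \<bullet> blinfun_apply Y y"
  shows "\<exists>Z. norm Z < 1 \<and> (\<forall>x y. blinfun_apply Z x \<bullet> y = x \<bullet> blinfun_apply Z y)
    \<and> (\<forall>x. 2 *\<^sub>R blinfun_apply Z x = blinfun_apply Y x + blinfun_apply Z (blinfun_apply Z x))"
proof -
  define q where "q = norm Y"
  have q: "0 \<le> q" "q < 1"
    using Y by (auto simp: q_def)
  define f where "f Z = (1 / 2) *\<^sub>R (Y + (Z o\<^sub>L Z))" for Z
  define S where "S = {Z :: 'a \<Rightarrow>\<^sub>L 'a. norm Z \<le> q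
      \<and> (\<forall>x y. blinfun_apply Z x \<bullet> y = x \<bullet> blinfun_apply Z y)}"
  have "closed S"
    unfolding S_def
    by (intro closed_Collect_conj closed_Collect_all closed_Collect_le closed_Collect_eq
        continuous_intros)
  note complete_eq_closed[THEN iffD2, OF this]
  moreover have "S \<noteq> {}"
    using sym by (auto simp: S_def q_def)
  moreover have "f Z \<in> S" if "Z \<in> S" for Z
  proof -
    have Z: "norm Z \<le> q" "\<And>x y. blinfun_apply Z x \<bullet> y = x \<bullet> blinfun_apply Z y"
      using that by (auto simp: S_def)
    have "norm (Z o\<^sub>L Z) \<le> norm Z * norm Z"
      by (rule norm_blinfun_compose)
    also have "\<dots> \<le> q * 1"
      using Z(1) q by (intro mult_mono) auto
    finally have "norm (Y + (Z o\<^sub>L Z)) \<le> q + q"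
      using norm_triangle_ineq[of Y "Z o\<^sub>L Z"] unfolding q_def by linarith
    then show ?thesis
      using Z(2) sym by (simp add: S_def f_def blinfun.bilinear_simps inner_add_left inner_add_right)
  qed
  moreover have "dist (f Z) (f W) \<le> q * dist Z W" if "Z \<in> S" "W \<in> S" for Z W
  proof -
    have "f Z - f W = (1 / 2) *\<^sub>R ((Z o\<^sub>L (Z - W)) + ((Z - W) o\<^sub>L W))"
      by (rule blinfun_eqI) (simp add: f_def blinfun.bilinear_simps algebra_simps)
    also have "norm \<dots> \<le> (1 / 2) * (norm Z * norm (Z - W) + norm (Z - W) * norm W)"
      using norm_triangle_mono[OF norm_blinfun_compose[of Z "Z - W"] norm_blinfun_compose[of "Z - W" W]]
      by simp
    also have "\<dots> \<le> (1 / 2) * (q * norm (Z - W) + norm (Z - W) * q)"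
      using that by (intro mult_left_mono add_mono mult_right_mono) (auto simp: S_def)
    finally show ?thesis
      by (simp add: dist_norm)
  qed
  ultimately obtain Z where Z: "Z \<in> S" "f Z = Z"
    using Banach_fix[of S q f] q by blast
  have "2 *\<^sub>R Z = Y + (Z o\<^sub>L Z)"
    using arg_cong[OF Z(2), of "\<lambda>Z. 2 *\<^sub>R Z"] by (simp add: f_def)
  then have "2 *\<^sub>R blinfun_apply Z x = blinfun_apply Y x + blinfun_apply Z (blinfun_apply Z x)" for x
    by (metis blinfun.add_left blinfun.scaleR_left blinfun_apply_blinfun_compose)
  then show ?thesis
    using Z(1) q by (intro exI[of _ Z]) (auto simp: S_def)
qed

text \<open>If \<open>m\<close> is the minimum of the quadratic form of \<open>A\<close> on the unit sphere and \<open>M\<close> bounds \<open>A\<close>, then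
  expanding the square gives the factor \<open>1 - 2 c m + c\<^sup>2 M\<^sup>2\<close> for the squared norm.  Its minimum over
  \<open>c\<close> is attained at \<open>c = m / M\<^sup>2\<close> and equals \<open>1 - m\<^sup>2 / M\<^sup>2\<close>.\<close>

lemma sym_pos_def_scaled_contraction:
  fixes A :: "real ^ 'n ^ 'n"
  assumes A: "sym_pos_def A"
  shows "\<exists>c q. 0 < c \<and> 0 \<le> q \<and> q < 1 \<and> (\<forall>x. norm (x - c *\<^sub>R (A *v x)) \<le> q * norm x)"
proof -
  obtain M where M: "M > 0" "\<And>x. norm (A *v x) \<le> M * norm x"
    using linear_bounded_pos[OF matrix_vector_mul_linear[of A]] by blast
  have "\<exists>m > 0. \<forall>x. m * (norm x)\<^sup>2 \<le> x \<bullet> (A *v x)"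
  proof -
    have "\<exists>u\<in>sphere 0 1. \<forall>x\<in>sphere 0 1. u \<bullet> (A *v u) \<le> x \<bullet> (A *v x)"
      by (intro continuous_attains_inf compact_sphere continuous_intros) simp
    then obtain u where u: "u \<in> sphere 0 1"
        "\<And>x. x \<in> sphere 0 1 \<Longrightarrow> u \<bullet> (A *v u) \<le> x \<bullet> (A *v x)"
      by blast
    have "(u \<bullet> (A *v u)) * (norm x)\<^sup>2 \<le> x \<bullet> (A *v x)" for x
    proof (cases "x = 0")
      case False
      then have "u \<bullet> (A *v u) \<le> (x /\<^sub>R norm x) \<bullet> (A *v (x /\<^sub>R norm x))"
        by (intro u(2)) simp
      also have "\<dots> = (x \<bullet> (A *v x)) / (norm x)\<^sup>2"
        by (simp add: matrix_vector_mult_scaleR power2_eq_square divide_simps)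
      finally show ?thesis
        using False by (simp add: field_simps)
    qed simp
    moreover have "u \<bullet> (A *v u) > 0"
      using u(1) by (intro sym_pos_def_pos[OF A]) auto
    ultimately show ?thesis
      by blast
  qed
  then obtain m where m: "m > 0" "\<And>x. m * (norm x)\<^sup>2 \<le> x \<bullet> (A *v x)"
    by blast
  define c where "c = m / M\<^sup>2"
  \<comment> \<open>The maximum with \<open>0\<close> makes the radicand visibly nonnegative.\<close>
  define q where "q = sqrt (max 0 (1 - m\<^sup>2 / M\<^sup>2))"
  have "c > 0"
    using m M by (simp add: c_def)
  moreover have "0 \<le> q" "q < 1"
    using m M by (auto simp: q_def)
  moreover have "norm (x - c *\<^sub>R (A *v x)) \<le> q * norm x" for x
  proof -
    have "(norm (x - c *\<^sub>R (A *v x)))\<^sup>2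
        = (norm x)\<^sup>2 - 2 * c * (x \<bullet> (A *v x)) + c\<^sup>2 * (norm (A *v x))\<^sup>2"
      unfolding power2_norm_eq_inner by (simp add: algebra_simps inner_commute power2_eq_square)
    also have "\<dots> \<le> (norm x)\<^sup>2 - 2 * c * (m * (norm x)\<^sup>2) + c\<^sup>2 * (M * norm x)\<^sup>2"
      using \<open>c > 0\<close> m(2)[of x] M
      by (intro add_mono diff_mono mult_left_mono power_mono) auto
    also have "\<dots> = (1 - m\<^sup>2 / M\<^sup>2) * (norm x)\<^sup>2"
      using M(1) by (simp add: c_def power2_eq_square field_simps)
    also have "\<dots> \<le> max 0 (1 - m\<^sup>2 / M\<^sup>2) * (norm x)\<^sup>2"
      by (intro mult_right_mono) auto
    also have "\<dots> = (q * norm x)\<^sup>2"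
      by (simp add: q_def power_mult_distrib)
    finally show ?thesis
      by (rule power2_le_imp_le) (use \<open>0 \<le> q\<close> in auto)
  qed
  ultimately show ?thesis
    by blast
qed

text \<open>Write \<open>c A = I - Y\<close> with \<open>norm Y < 1\<close> and take the root \<open>I - Z\<close> of \<open>I - Y\<close>; it is positive definite
  because \<open>norm Z < 1\<close>.  Dividing by \<open>sqrt c\<close> gives a root of \<open>A\<close>.\<close>

lemma sym_pos_def_sqrt_exists:
  fixes A :: "real ^ 'n ^ 'n"
  assumes A: "sym_pos_def A"
  shows "\<exists>B. sym_pos_def B \<and> B ** B = A"
proof -
  obtain c q where c: "c > 0" and q: "0 \<le> q" "q < 1"
      and contr: "\<And>x. norm (x - c *\<^sub>R (A *v x)) \<le> q * norm x"
    using sym_pos_def_scaled_contraction[OF A] by blast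
  define Y where "Y = Blinfun (\<lambda>x. x - c *\<^sub>R (A *v x))"
  have Y: "blinfun_apply Y x = x - c *\<^sub>R (A *v x)" for x
    unfolding Y_def
    by (subst bounded_linear_Blinfun_apply)
       (auto intro!: bounded_linear_sub bounded_linear_ident bounded_linear_scaleR_right
         bounded_linear_compose[OF bounded_linear_scaleR_right] matrix_vector_mul_bounded_linear)
  have "norm Y \<le> q"
    by (rule norm_blinfun_bound) (auto simp: Y q contr)
  then have "norm Y < 1"
    using q by simp
  moreover have "blinfun_apply Y x \<bullet> y = x \<bullet> blinfun_apply Y y" for x y
    using inner_matrix_vector[of x A y] sym_pos_def_symmetric[OF A]
    by (simp add: Y inner_diff_left inner_diff_right)
  ultimately obtain Z where Z: "norm Z < 1"
      "\<And>x y. blinfun_apply Z x \<bullet> y = x \<bullet> blinfun_apply Z y"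
      "\<And>x. 2 *\<^sub>R blinfun_apply Z x = blinfun_apply Y x + blinfun_apply Z (blinfun_apply Z x)"
    using contraction_has_symmetric_root[of Y] by blast
  define R where "R x = (1 / sqrt c) *\<^sub>R (x - blinfun_apply Z x)" for x
  have lin: "linear R"
    unfolding R_def
    by (intro linearI) (simp_all add: blinfun.bilinear_simps algebra_simps)
  define B where "B = matrix R"
  have B: "B *v x = R x" for x
    using lin by (simp add: B_def matrix_works)
  have "B ** B = A"
  proof -
    have "R (R x) = A *v x" for x
    proof -
      have "R (R x) = (1 / c) *\<^sub>R (x - 2 *\<^sub>R blinfun_apply Z x + blinfun_apply Z (blinfun_apply Z x))"
        using c by (simp add: R_def blinfun.bilinear_simps algebra_simps scaleR_2)
      also have "\<dots> = (1 / c) *\<^sub>R (c *\<^sub>R (A *v x))"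
        by (simp add: Z(3) Y)
      finally show ?thesis
        using c by simp
    qed
    then show ?thesis
      by (simp add: matrix_eq matrix_vector_mul_assoc[symmetric] B)
  qed
  moreover have "transpose B = B"
  proof -
    have "x \<bullet> (transpose B *v y) = x \<bullet> (B *v y)" for x y
      using inner_matrix_vector[of x "transpose B" y] Z(2)
      by (simp add: B R_def inner_diff_left inner_diff_right)
    then show ?thesis
      by (metis matrix_eq vector_eq_ldot)
  qed
  moreover have "x \<bullet> (B *v x) > 0" if "x \<noteq> 0" for x
  proof -
    have "x \<bullet> blinfun_apply Z x \<le> norm x * norm (blinfun_apply Z x)"
      by (rule norm_cauchy_schwarz)
    also have "\<dots> \<le> norm x * (norm Z * norm x)"
      by (intro mult_left_mono norm_blinfun) auto
    also have "\<dots> < norm x * (1 * norm x)"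
      using that Z(1) by (intro mult_strict_left_mono mult_strict_right_mono) auto
    finally have "x \<bullet> (x - blinfun_apply Z x) > 0"
      by (simp add: inner_diff_right dot_square_norm power2_eq_square)
    then show ?thesis
      using c by (simp add: B R_def)
  qed
  ultimately show ?thesis
    by (auto simp: sym_pos_def_def)
qed

text \<open>Existence and uniqueness together give the definite description its intended meaning.\<close>

lemma sym_pos_def_spd_sqrt:
  fixes A :: "real ^ 'n ^ 'n"
  assumes A: "sym_pos_def A"
  shows "sym_pos_def (spd_sqrt A)"
proof -
  have "\<exists>!B. sym_pos_def B \<and> B ** B = A"
    using sym_pos_def_sqrt_exists[OF A] sym_pos_def_sqrt_unique by metis
  from theI'[OF this] show ?thesis
    unfolding spd_sqrt_def by blast
qed

section \<open>First moments of tilted Gaussians\<close>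

text \<open>The integrand factors over the coordinates, and each factor is a multiple of a normal density.\<close>

lemma integrable_exp_neg_norm_sq:
  fixes \<alpha> :: real
  assumes "\<alpha> > 0"
  shows "integrable lborel (\<lambda>x :: 'a::euclidean_space. exp (- \<alpha> * (norm x)\<^sup>2))"
proof -
  have 1: "integrable lborel (\<lambda>x :: real. exp (- \<alpha> * x\<^sup>2))"
  proof -
    define \<sigma> where "\<sigma> = sqrt (1 / (2 * \<alpha>))"
    have \<sigma>: "\<sigma> > 0" "2 * \<sigma>\<^sup>2 = 1 / \<alpha>"
      using assms by (simp_all add: \<sigma>_def)
    have "exp (- \<alpha> * x\<^sup>2) = sqrt (2 * pi * \<sigma>\<^sup>2) * normal_density 0 \<sigma> x" for x
      using \<sigma> assms by (simp add: normal_density_def mult_ac)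
    then show ?thesis
      using \<sigma> by simp
  qed
  have "(\<integral>\<^sup>+x. exp (- \<alpha> * (norm (x :: 'a))\<^sup>2) \<partial>lborel)
      = (\<integral>\<^sup>+x. (\<Prod>b\<in>Basis. ennreal (exp (- \<alpha> * (x \<bullet> b)\<^sup>2))) \<partial>(lborel :: 'a measure))"
    by (simp add: prod_ennreal exp_sum[symmetric] sum_distrib_left[symmetric] sum_negf
        norm_eq_sqrt_inner euclidean_inner[of x x for x :: 'a] sum_nonneg power2_eq_square)
  also have "\<dots> = (\<Prod>b\<in>(Basis :: 'a set). (\<integral>\<^sup>+x. ennreal (exp (- \<alpha> * x\<^sup>2)) \<partial>lborel))"
    by (intro nn_integral_lborel_prod) auto
  also have "\<dots> < \<infinity>"
    using 1 by (simp add: nn_integral_eq_integral ennreal_prod_eq_top power_less_top_ennreal)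
  finally show ?thesis
    by (intro integrableI_nonneg) auto
qed

lemma le_exp_quarter_sq: "r \<le> 2 * exp (r\<^sup>2 / 4)" for r :: real
proof -
  have "r \<le> 2 * (1 + r\<^sup>2 / 4)"
    using zero_le_power2[of "r - 1"] by (simp add: power2_eq_square algebra_simps)
  also have "\<dots> \<le> 2 * exp (r\<^sup>2 / 4)"
    by (intro mult_left_mono exp_ge_add_one_self) auto
  finally show ?thesis .
qed

text \<open>A linear factor costs only an arbitrarily small part of a Gaussian exponent; giving up the
  amount \<open>1 / 4\<close> is enough for every integrability claim below.\<close>

lemma abs_inner_times_exp_le:
  fixes x c :: "'a::euclidean_space"
  shows "\<bar>x \<bullet> c\<bar> * exp (- a * (norm x)\<^sup>2) \<le> 2 * norm c * exp (- (a - 1 / 4) * (norm x)\<^sup>2)"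
proof -
  have "\<bar>x \<bullet> c\<bar> \<le> norm x * norm c"
    by (rule Cauchy_Schwarz_ineq2)
  also have "\<dots> \<le> 2 * exp ((norm x)\<^sup>2 / 4) * norm c"
    by (intro mult_right_mono le_exp_quarter_sq) auto
  finally have "\<bar>x \<bullet> c\<bar> * exp (- a * (norm x)\<^sup>2)
      \<le> 2 * exp ((norm x)\<^sup>2 / 4) * norm c * exp (- a * (norm x)\<^sup>2)"
    by (intro mult_right_mono) auto
  also have "\<dots> = 2 * norm c * exp (- (a - 1 / 4) * (norm x)\<^sup>2)"
    by (simp add: mult_exp_exp algebra_simps)
  finally show ?thesis .
qed

lemma integral_odd_eq_0:
  fixes f :: "'a::euclidean_space \<Rightarrow> real"
  assumes "\<And>x. f (- x) = - f x"
  shows "integral\<^sup>L lborel f = 0"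
proof (cases "f \<in> borel_measurable borel")
  case True
  have "integral\<^sup>L lborel f = integral\<^sup>L (distr lborel borel uminus) f"
    using lborel_affine[of "-1" "0 :: 'a"] by (simp add: density_1)
  also have "\<dots> = (\<integral>x. f (- x) \<partial>lborel)"
    using True by (intro integral_distr) auto
  also have "\<dots> = - integral\<^sup>L lborel f"
    by (simp add: assms)
  finally show ?thesis
    by simp
qed (auto intro!: not_integrable_integral_eq dest: borel_measurable_integrable)

lemma gaussian_integral_pos: "(\<integral>x. exp (- (norm (x :: 'a::euclidean_space))\<^sup>2) \<partial>lborel) > 0"
proof -
  have i: "integrable lborel (\<lambda>x :: 'a. exp (- (norm x)\<^sup>2))"
    using integrable_exp_neg_norm_sq[of 1, where 'a = 'a] by simp
  have "(\<integral>x. exp (- (norm (x :: 'a))\<^sup>2) \<partial>lborel) \<noteq> 0"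
    by (subst integral_nonneg_eq_0_iff_AE[OF i])
       (simp_all add: eventually_False ae_filter_eq_bot_iff)
  moreover have "(\<integral>x. exp (- (norm (x :: 'a))\<^sup>2) \<partial>lborel) \<ge> 0"
    by simp
  ultimately show ?thesis by linarith
qed

text \<open>Completing the square: the factor \<open>exp (x \<bullet> v)\<close> moves the centre of the Gaussian from \<open>0\<close> to
  \<open>v / 2\<close>.  After translating back, the linear part is odd and integrates to zero, which leaves
  the value of \<open>x \<bullet> c\<close> at the centre.  The lemma is applied twice, once in \<open>s\<close> and once
  in \<open>t\<close>.\<close>

lemma tilted_gaussian_first_moment:
  fixes v c :: "'a::euclidean_space"
  shows "(\<integral>x. (x \<bullet> c) * exp (x \<bullet> v - (norm x)\<^sup>2) \<partial>lborel)
    = (v \<bullet> c) / 2 * exp ((norm v)\<^sup>2 / 4) * (\<integral>x. exp (- (norm (x :: 'a))\<^sup>2) \<partial>lborel)"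
proof -
  let ?g = "\<lambda>x :: 'a. (x \<bullet> c) * exp (x \<bullet> v - (norm x)\<^sup>2)"
  let ?e = "\<lambda>x :: 'a. exp (- (norm x)\<^sup>2)"
  have e: "integrable lborel ?e"
    using integrable_exp_neg_norm_sq[of 1, where 'a = 'a] by simp
  have xe: "integrable lborel (\<lambda>x. (x \<bullet> c) * ?e x)"
  proof (rule Bochner_Integration.integrable_bound)
    show "integrable lborel (\<lambda>x :: 'a. 2 * norm c * exp (- (3 / 4) * (norm x)\<^sup>2))"
      by (intro integrable_mult_right integrable_exp_neg_norm_sq) auto
    show "AE x in lborel. norm ((x \<bullet> c) * ?e x)
        \<le> norm (2 * norm c * exp (- (3 / 4) * (norm x)\<^sup>2))"
      using abs_inner_times_exp_le[of _ c 1] by (intro always_eventually) (auto simp: abs_mult)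
  qed auto
  have shift: "?g (v /\<^sub>R 2 + y) = exp ((norm v)\<^sup>2 / 4) * ((y \<bullet> c) * ?e y)
      + (v \<bullet> c) / 2 * exp ((norm v)\<^sup>2 / 4) * ?e y" for y
  proof -
    have "(v /\<^sub>R 2 + y) \<bullet> v - (norm (v /\<^sub>R 2 + y))\<^sup>2 = (norm v)\<^sup>2 / 4 + - (norm y)\<^sup>2"
      unfolding power2_norm_eq_inner by (simp add: algebra_simps inner_commute)
    then show ?thesis
      by (simp only: exp_add) (simp add: algebra_simps)
  qed
  have "integral\<^sup>L lborel ?g = integral\<^sup>L (distr lborel borel ((+) (v /\<^sub>R 2))) ?g"
    by (simp add: lborel_distr_plus)
  also have "\<dots> = (\<integral>y. ?g (v /\<^sub>R 2 + y) \<partial>lborel)"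
    by (intro integral_distr) auto
  also have "\<dots> = exp ((norm v)\<^sup>2 / 4) * (\<integral>y. (y \<bullet> c) * ?e y \<partial>lborel)
      + (v \<bullet> c) / 2 * exp ((norm v)\<^sup>2 / 4) * integral\<^sup>L lborel ?e"
    unfolding shift using e xe by simp
  also have "(\<integral>y. (y \<bullet> c) * ?e y \<partial>lborel) = 0"
    by (rule integral_odd_eq_0) simp
  finally show ?thesis
    by simp
qed

section \<open>The tilting test function\<close>

text \<open>The exponent is designed for \<open>tilted_gaussian_first_moment\<close>.  The tilt \<open>s \<bullet> A t\<close> gives \<open>S\<close> a drift
  in direction \<open>A t\<close>.  The term \<open>(norm s)\<^sup>2 / 2\<close> turns the exponent of the standard normal density
  into \<open>(norm s)\<^sup>2\<close>; the term \<open>(norm (A t))\<^sup>2 / 4\<close> cancels the normalizing factor which the integration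
  over \<open>s\<close> produces, so that the result is linear in \<open>A t\<close> up to a radial weight in \<open>t\<close>.  The
  last term is that weight, which keeps the function bounded and makes the integral over \<open>t\<close> one
  of the same kind.\<close>

definition tilt_test :: "('a::euclidean_space \<Rightarrow> 'a) \<Rightarrow> 'a \<times> 'a \<Rightarrow> real" where
  "tilt_test A = (\<lambda>(s, t).
     exp (s \<bullet> A t - (norm s)\<^sup>2 / 2 - (norm (A t))\<^sup>2 / 4 - (norm t)\<^sup>2 / 2))"

lemma tilt_test_nonneg: "0 \<le> tilt_test A z"
  by (simp add: tilt_test_def split: prod.split)

text \<open>If \<open>A\<close> is a contraction then the exponent is nonpositive: by Young's inequality \<open>s \<bullet> A t\<close> exceeds
  \<open>(norm s)\<^sup>2 / 2 + (norm (A t))\<^sup>2 / 4\<close> by at most \<open>(norm (A t))\<^sup>2 / 4\<close>, and the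
  weight \<open>(norm t)\<^sup>2 / 2\<close> makes up for that.\<close>

lemma tilt_test_le_1:
  assumes "norm (A t) \<le> norm t"
  shows "tilt_test A (s, t) \<le> 1"
proof -
  have "(norm (A t))\<^sup>2 \<le> (norm t)\<^sup>2"
    using assms by (intro power_mono) auto
  moreover have "0 \<le> (norm (s - A t))\<^sup>2"
    by simp
  then have "2 * (s \<bullet> A t) \<le> (norm s)\<^sup>2 + (norm (A t))\<^sup>2"
    unfolding power2_norm_eq_inner by (simp add: algebra_simps inner_commute)
  moreover have "0 \<le> (norm (A t))\<^sup>2" by simp
  ultimately have "s \<bullet> A t - (norm s)\<^sup>2 / 2 - (norm (A t))\<^sup>2 / 4 - (norm t)\<^sup>2 / 2 \<le> 0"
    by linarith
  then show ?thesis
    by (simp add: tilt_test_def)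
qed

lemma test_function_tilt_test:
  fixes A :: "real ^ 'k \<Rightarrow> real ^ 'k"
  assumes "linear A" and "\<And>t. norm (A t) \<le> norm t"
  shows "test_function (tilt_test A)"
proof -
  have "continuous_on UNIV (tilt_test A)"
    unfolding tilt_test_def case_prod_unfold
    by (intro continuous_intros linear_continuous_on_compose[OF _ assms(1)]) auto
  then have "tilt_test A \<in> borel_measurable borel"
    by (rule borel_measurable_continuous_onI)
  then show ?thesis
    using tilt_test_le_1[of A] assms(2)
    by (auto simp: test_function_def tilt_test_nonneg)
qed

text \<open>The integrand is dominated by a Gaussian on the product space, which is itself Euclidean.  This
  justifies Fubini's theorem below.\<close>

lemma integrable_moment_gauss_pair:
  fixes c \<mu> :: "real ^ 'k"
  assumes "test_function \<phi>"
  shows "integrable lborel (\<lambda>(s, t). \<phi> (s, t) * (s \<bullet> c) * f_S s * gauss_density \<mu> t)"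
proof (rule Bochner_Integration.integrable_bound)
  let ?N = "(2 * pi) powr (- real CARD('k) / 2)"
  let ?B = "\<lambda>z :: (real ^ 'k) \<times> (real ^ 'k). ?N * ?N * 2 * norm c * exp ((norm \<mu>)\<^sup>2 / 2)
      * exp (- (1 / 4) * (norm z)\<^sup>2)"
  show "integrable lborel ?B"
    by (intro integrable_mult_right integrable_exp_neg_norm_sq) auto
  have \<phi>: "\<phi> \<in> borel_measurable borel" "\<And>z. 0 \<le> \<phi> z" "\<And>z. \<phi> z \<le> 1"
    using assms by (auto simp: test_function_def)
  have fS: "f_S \<in> borel_measurable (borel :: (real ^ 'k) measure)"
    by (simp add: f_S_def borel_measurable_gauss_density)
  show "(\<lambda>(s, t). \<phi> (s, t) * (s \<bullet> c) * f_S s * gauss_density \<mu> t) \<in> borel_measurable lborel"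
    unfolding case_prod_unfold prod.collapse measurable_lborel2
    by (intro borel_measurable_times \<phi>(1) measurable_compose[OF _ fS]
        measurable_compose[OF _ borel_measurable_gauss_density] borel_measurable_inner
        borel_measurable_continuous_onI continuous_intros)
  have "\<bar>\<phi> (s, t) * (s \<bullet> c) * f_S s * gauss_density \<mu> t\<bar> \<le> ?B (s, t)" for s t
  proof -
    have s: "\<bar>s \<bullet> c\<bar> * f_S s \<le> ?N * (2 * norm c * exp (- (1 / 4) * (norm s)\<^sup>2))"
    proof -
      have "\<bar>s \<bullet> c\<bar> * f_S s = ?N * (\<bar>s \<bullet> c\<bar> * exp (- (1 / 2) * (norm s)\<^sup>2))"
        by (simp add: f_S_def gauss_density_def)
      also have "\<dots> \<le> ?N * (2 * norm c * exp (- (1 / 2 - 1 / 4) * (norm s)\<^sup>2))"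
        by (intro mult_left_mono abs_inner_times_exp_le) auto
      finally show ?thesis
        by simp
    qed
    \<comment> \<open>Compares the Gaussian centred at \<open>\<mu>\<close> with one centred at \<open>0\<close>, at the price of a smaller exponent.\<close>
    have "(norm t)\<^sup>2 \<le> 2 * (norm (t - \<mu>))\<^sup>2 + 2 * (norm \<mu>)\<^sup>2"
    proof -
      have "0 \<le> (norm (t - 2 *\<^sub>R \<mu>))\<^sup>2" by simp
      then show ?thesis
        unfolding power2_norm_eq_inner by (simp add: algebra_simps inner_commute)
    qed
    then have "- (norm (t - \<mu>))\<^sup>2 / 2 \<le> (norm \<mu>)\<^sup>2 / 2 + - (1 / 4) * (norm t)\<^sup>2"
      by simp
    then have t: "gauss_density \<mu> t \<le> ?N * (exp ((norm \<mu>)\<^sup>2 / 2) * exp (- (1 / 4) * (norm t)\<^sup>2))"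
      unfolding gauss_density_def exp_add[symmetric] by (intro mult_left_mono) auto
    have pos: "f_S s \<ge> 0" "gauss_density \<mu> t \<ge> 0"
      by (simp_all add: f_S_def gauss_density_def)
    have "\<bar>\<phi> (s, t) * (s \<bullet> c) * f_S s * gauss_density \<mu> t\<bar>
        = \<phi> (s, t) * ((\<bar>s \<bullet> c\<bar> * f_S s) * gauss_density \<mu> t)"
      using \<phi>(2)[of "(s, t)"] pos by (simp add: abs_mult)
    also have "\<dots> \<le> (\<bar>s \<bullet> c\<bar> * f_S s) * gauss_density \<mu> t"
      using \<phi>(2,3)[of "(s, t)"] pos by (intro mult_left_le_one_le) auto
    also have "\<dots> \<le> (?N * (2 * norm c * exp (- (1 / 4) * (norm s)\<^sup>2)))
        * (?N * (exp ((norm \<mu>)\<^sup>2 / 2) * exp (- (1 / 4) * (norm t)\<^sup>2)))"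
      using pos by (intro mult_mono[OF s t]) auto
    also have "\<dots> = ?B (s, t)"
    proof -
      have e: "exp (- (1 / 4) * (norm (s, t))\<^sup>2)
          = exp (- (1 / 4) * (norm s)\<^sup>2) * exp (- (1 / 4) * (norm t)\<^sup>2)"
        by (simp add: norm_Pair exp_add[symmetric] field_simps)
      show ?thesis
        unfolding e by (simp only: mult_ac)
    qed
    finally show ?thesis .
  qed
  then show "AE z in lborel. norm (case z of (s, t) \<Rightarrow>
      \<phi> (s, t) * (s \<bullet> c) * f_S s * gauss_density \<mu> t) \<le> norm (?B z)"
    by (intro always_eventually) (auto intro: order_trans[OF _ abs_ge_self])
qed

text \<open>Integrating over \<open>s\<close> replaces \<open>s \<bullet> c\<close> by a multiple of \<open>A t \<bullet> c\<close>; completing the square in \<open>t\<close>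
  then gives the same kind of integral with tilt \<open>\<mu>\<close>, which replaces \<open>t\<close> by a multiple of \<open>\<mu>\<close>.
  The factor \<open>K\<close> depends on \<open>\<mu>\<close>, but only its sign matters.\<close>

lemma tilt_test_moment:
  fixes A :: "real ^ 'k \<Rightarrow> real ^ 'k" and c \<mu> :: "real ^ 'k"
  assumes A: "linear A" "\<And>t. norm (A t) \<le> norm t"
  shows "\<exists>K > 0. (LINT (s, t)|lborel. tilt_test A (s, t) * (s \<bullet> c) * f_S s * gauss_density \<mu> t)
    = K * (A \<mu> \<bullet> c)"
proof -
  define N where "N = (2 * pi) powr (- real CARD('k) / 2)"
  define Z where "Z = (\<integral>x. exp (- (norm (x :: real ^ 'k))\<^sup>2) \<partial>lborel)"
  have NZ: "N > 0" "Z > 0"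
    using gaussian_integral_pos by (auto simp: N_def Z_def)
  have integral_s: "(\<integral>s. tilt_test A (s, t) * (s \<bullet> c) * f_S s * gauss_density \<mu> t \<partial>lborel)
      = N * N * Z / 2 * exp (- (norm \<mu>)\<^sup>2 / 2) * ((t \<bullet> adjoint A c) * exp (t \<bullet> \<mu> - (norm t)\<^sup>2))"
    for t
  proof -
    have eq: "tilt_test A (s, t) * (s \<bullet> c) * f_S s * gauss_density \<mu> t
        = N * exp (- (norm (A t))\<^sup>2 / 4 - (norm t)\<^sup>2 / 2) * gauss_density \<mu> t
          * ((s \<bullet> c) * exp (s \<bullet> A t - (norm s)\<^sup>2))" for s
    proof -
      have "s \<bullet> A t - (norm s)\<^sup>2 / 2 - (norm (A t))\<^sup>2 / 4 - (norm t)\<^sup>2 / 2 + - (norm s)\<^sup>2 / 2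
          = (- (norm (A t))\<^sup>2 / 4 - (norm t)\<^sup>2 / 2) + (s \<bullet> A t - (norm s)\<^sup>2)"
        by simp
      then have "tilt_test A (s, t) * exp (- (norm s)\<^sup>2 / 2)
          = exp (- (norm (A t))\<^sup>2 / 4 - (norm t)\<^sup>2 / 2) * exp (s \<bullet> A t - (norm s)\<^sup>2)"
        by (simp only: tilt_test_def prod.case exp_add[symmetric])
      then show ?thesis
        by (simp add: f_S_def gauss_density_def[of 0 s] N_def mult_ac)
    qed
    have "(\<integral>s. tilt_test A (s, t) * (s \<bullet> c) * f_S s * gauss_density \<mu> t \<partial>lborel)
        = N * exp (- (norm (A t))\<^sup>2 / 4 - (norm t)\<^sup>2 / 2) * gauss_density \<mu> t
          * ((A t \<bullet> c) / 2 * exp ((norm (A t))\<^sup>2 / 4) * Z)"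
      unfolding eq by (simp add: tilted_gaussian_first_moment Z_def)
    also have "\<dots> = N * Z / 2 * (A t \<bullet> c) * (gauss_density \<mu> t * exp (- (norm t)\<^sup>2 / 2))"
    proof -
      have "exp (- (norm (A t))\<^sup>2 / 4 - (norm t)\<^sup>2 / 2) * exp ((norm (A t))\<^sup>2 / 4)
          = exp (- (norm t)\<^sup>2 / 2)"
        by (simp add: exp_add[symmetric])
      from this[symmetric] show ?thesis
        by (simp only:) (simp add: mult_ac)
    qed
    also have "gauss_density \<mu> t * exp (- (norm t)\<^sup>2 / 2)
        = N * exp (- (norm \<mu>)\<^sup>2 / 2) * exp (t \<bullet> \<mu> - (norm t)\<^sup>2)"
    proof -
      have "- (norm (t - \<mu>))\<^sup>2 / 2 + - (norm t)\<^sup>2 / 2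
          = - (norm \<mu>)\<^sup>2 / 2 + (t \<bullet> \<mu> - (norm t)\<^sup>2)"
        unfolding power2_norm_eq_inner
        by (simp add: inner_diff_left inner_diff_right inner_commute field_simps)
      then show ?thesis
        by (simp only: gauss_density_def N_def mult.assoc exp_add[symmetric])
    qed
    finally show ?thesis
      using adjoint_works[OF A(1), of t c] by (simp add: mult_ac)
  qed
  have "(LINT (s, t)|lborel. tilt_test A (s, t) * (s \<bullet> c) * f_S s * gauss_density \<mu> t)
      = (\<integral>t. (\<integral>s. tilt_test A (s, t) * (s \<bullet> c) * f_S s * gauss_density \<mu> t \<partial>lborel) \<partial>lborel)"
    using integrable_moment_gauss_pair[OF test_function_tilt_test[OF A], of c \<mu>]
    unfolding lborel_prod[symmetric] by (intro lborel_pair.integral_snd[symmetric]) simp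
  also have "\<dots> = N * N * Z / 2 * exp (- (norm \<mu>)\<^sup>2 / 2)
      * ((\<mu> \<bullet> adjoint A c) / 2 * exp ((norm \<mu>)\<^sup>2 / 4) * Z)"
    unfolding integral_s by (simp add: tilted_gaussian_first_moment Z_def)
  also have "\<dots> = (N * N * Z * Z / 4 * exp (- (norm \<mu>)\<^sup>2 / 2) * exp ((norm \<mu>)\<^sup>2 / 4)) * (A \<mu> \<bullet> c)"
    using adjoint_works[OF A(1), of \<mu> c] by simp
  finally show ?thesis
    using NZ by (intro exI[of _ "N * N * Z * Z / 4 * exp (- (norm \<mu>)\<^sup>2 / 2) * exp ((norm \<mu>)\<^sup>2 / 4)"])
      simp
qed

section \<open>The matrices \<open>C_mat\<close> and \<open>D_mat\<close>\<close>

text \<open>The blocks of \<open>(v \<otimes> I) x\<close> are the multiples \<open>v $ a *\<^sub>R x\<close>, and some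
  coefficient \<open>v $ a\<close> is nonzero.\<close>

lemma kron_vec_mat_1_mult_eq_0:
  fixes x :: "real ^ 'k"
  assumes "v \<noteq> 0" and "kron_vec v (mat 1) *v x = 0"
  shows "x = 0"
proof -
  obtain a where a: "v $ a \<noteq> 0"
    using assms(1) by (auto simp: vec_eq_iff)
  have "(kron_vec v (mat 1) *v x) $ (a, i) = v $ a * x $ i" for i
    by (simp add: kron_vec_def matrix_vector_mult_def mat_def if_distrib if_distribR cong: if_cong)
  then show ?thesis
    using assms(2) a by (simp add: vec_eq_iff)
qed

lemma sym_pos_def_C_mat:
  fixes \<Sigma> :: "real ^ (2 \<times> 'k::finite) ^ (2 \<times> 'k)"
  assumes "sym_pos_def \<Sigma>"
  shows "sym_pos_def (C_mat \<beta>\<^sub>0 \<Sigma>)"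
proof -
  have "b0 \<beta>\<^sub>0 $ 1 = 1"
    by (simp add: b0_def)
  then have "b0 \<beta>\<^sub>0 \<noteq> 0"
    by force
  note K = kron_vec_mat_1_mult_eq_0[OF this]
  show ?thesis
    unfolding C_mat_def
    by (rule sym_pos_def_matrix_inv[OF sym_pos_def_spd_sqrt[OF
          sym_pos_def_congruence[OF assms K]]])
qed

lemma sym_pos_def_D_mat:
  fixes \<Sigma> :: "real ^ (2 \<times> 'k::finite) ^ (2 \<times> 'k)"
  assumes "sym_pos_def \<Sigma>"
  shows "sym_pos_def (D_mat \<beta>\<^sub>0 \<Sigma>)"
proof -
  have "a0 \<beta>\<^sub>0 $ 2 = 1"
    by (simp add: a0_def)
  then have "a0 \<beta>\<^sub>0 \<noteq> 0"
    by force
  note K = kron_vec_mat_1_mult_eq_0[OF this]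
  show ?thesis
    unfolding D_mat_def
    by (rule sym_pos_def_spd_sqrt[OF sym_pos_def_congruence[OF
          sym_pos_def_matrix_inv[OF assms] K]])
qed

text \<open>Invertibility of \<open>D_mat\<close> makes the two occurrences in the mean of \<open>T\<close> cancel.\<close>

lemma F_eq_gauss_moment:
  fixes \<Sigma> :: "real ^ (2 \<times> 'k::finite) ^ (2 \<times> 'k)"
  assumes "sym_pos_def \<Sigma>"
  shows "F \<beta>\<^sub>0 \<Sigma> \<phi> \<mu>\<^sub>1 \<mu>\<^sub>2 =
    (LINT (s, t)|lborel. \<phi> (s, t) * (s \<bullet> (C_mat \<beta>\<^sub>0 \<Sigma> *v \<mu>\<^sub>1)) * f_S s * gauss_density \<mu>\<^sub>2 t)"
proof -
  have "D_mat \<beta>\<^sub>0 \<Sigma> ** matrix_inv (D_mat \<beta>\<^sub>0 \<Sigma>) = mat 1"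
    by (intro matrix_inv_right_inverse sym_pos_def_invertible sym_pos_def_D_mat assms)
  then show ?thesis
    by (simp add: F_def f_T_def matrix_vector_mul_assoc)
qed

section \<open>A test function with a skew-symmetric moment\<close>

theorem lemma7:
  fixes \<beta>\<^sub>0 :: real and \<Sigma> :: "real ^ (2 \<times> 'k::finite) ^ (2 \<times> 'k)"
  assumes "sym_pos_def \<Sigma>" and "CARD('k) > 1"
  shows "\<exists>\<phi> :: (real ^ 'k) \<times> (real ^ 'k) \<Rightarrow> real. test_function \<phi>
    \<and> (\<forall>\<mu>\<^sub>1. F \<beta>\<^sub>0 \<Sigma> \<phi> \<mu>\<^sub>1 \<mu>\<^sub>1 = 0)
    \<and> (\<exists>\<mu>\<^sub>1 \<mu>\<^sub>2. F \<beta>\<^sub>0 \<Sigma> \<phi> \<mu>\<^sub>1 \<mu>\<^sub>2 \<noteq> 0)"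
proof -
  obtain i j :: 'k where ij: "i \<noteq> j"
  proof -
    have "\<exists>i j :: 'k. i \<noteq> j"
    proof (rule ccontr)
      assume "\<nexists>i j :: 'k. i \<noteq> j"
      then have "(UNIV :: 'k set) = {undefined}"
        by blast
      then have "CARD('k) = card {undefined :: 'k}"
        by (rule arg_cong)
      then show False
        using assms(2) by simp
    qed
    then show ?thesis
      using that by blast
  qed
  define J :: "real ^ 'k \<Rightarrow> real ^ 'k" where "J x = x $ i *\<^sub>R axis j 1 - x $ j *\<^sub>R axis i 1" for x
  have "linear J"
    unfolding J_def by (intro linearI) (simp_all add: algebra_simps)
  have J_skew: "J x \<bullet> x = 0" for x
    by (simp add: J_def inner_diff_left inner_axis')
  have J_nonzero: "J (axis i 1) \<bullet> axis j 1 = 1"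
    using ij by (simp add: J_def inner_diff_left inner_axis_axis)
  define C where "C = C_mat \<beta>\<^sub>0 \<Sigma>"
  have C: "sym_pos_def C"
    unfolding C_def by (rule sym_pos_def_C_mat[OF assms(1)])
  let ?B = "\<lambda>x. matrix_inv C *v J x"
  have lin: "linear ?B"
    by (rule linear_compose[OF \<open>linear J\<close> matrix_vector_mul_linear, unfolded o_def])
  have BC: "?B x \<bullet> (C *v y) = J x \<bullet> y" for x y
    by (simp add: inner_matrix_vector sym_pos_def_symmetric[OF C] matrix_vector_mul_assoc
        matrix_inv_right_inverse[OF sym_pos_def_invertible[OF C]])
  obtain M where M: "M > 0" "\<And>x. norm (?B x) \<le> M * norm x"
    using linear_bounded_pos[OF lin] by blast
  \<comment> \<open>Dividing by the bound \<open>M\<close> makes the map a contraction, so that \<open>tilt_test A\<close> is at most \<open>1\<close>.\<close>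
  define A where "A x = (1 / M) *\<^sub>R ?B x" for x
  have A: "linear A" "norm (A x) \<le> norm x" for x
    using linear_compose_scale_right[OF lin, of "1 / M"] M
    by (simp_all add: A_def[abs_def] divide_simps mult.commute)
  have F: "\<exists>K > 0. F \<beta>\<^sub>0 \<Sigma> (tilt_test A) \<mu>\<^sub>1 \<mu>\<^sub>2 = K * (J \<mu>\<^sub>2 \<bullet> \<mu>\<^sub>1)" for \<mu>\<^sub>1 \<mu>\<^sub>2
  proof -
    obtain K where K: "K > 0" "F \<beta>\<^sub>0 \<Sigma> (tilt_test A) \<mu>\<^sub>1 \<mu>\<^sub>2 = K * (A \<mu>\<^sub>2 \<bullet> (C *v \<mu>\<^sub>1))"
      unfolding F_eq_gauss_moment[OF assms(1)] C_def[symmetric]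
      using tilt_test_moment[OF A, where c = "C *v \<mu>\<^sub>1" and \<mu> = \<mu>\<^sub>2] by blast
    moreover have "A \<mu>\<^sub>2 \<bullet> (C *v \<mu>\<^sub>1) = (J \<mu>\<^sub>2 \<bullet> \<mu>\<^sub>1) / M"
      by (simp add: A_def BC)
    ultimately show ?thesis
      using M(1) by (intro exI[of _ "K / M"]) simp
  qed
  have "F \<beta>\<^sub>0 \<Sigma> (tilt_test A) \<mu> \<mu> = 0" for \<mu>
    using F[of \<mu> \<mu>] by (auto simp: J_skew)
  moreover have "F \<beta>\<^sub>0 \<Sigma> (tilt_test A) (axis j 1) (axis i 1) \<noteq> 0"
    using F[of "axis j 1" "axis i 1"] by (auto simp: J_nonzero)
  moreover have "test_function (tilt_test A)"
    by (rule test_function_tilt_test[OF A])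
  ultimately show ?thesis
    by blast
qed

end
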